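(* Let $P\in\mathcal{P}_n$ be a path that starts with $d$ and let $k$ be a positive integer. Then there exists a bijection between the $P-\mathbf{1}_n$ multichains $C$ of length $k$ in $\mathcal{P}_n$ and the shifted tableaux $T$ of shape $\lambda(P)$ with $\max(T)\le k$. In particular, for $C$ and $T$ corresponding to each other under this bijection: (i) $C$ is a chain iff the entries of $T$ form the interval $[k]=\{1,\dots,k\}$; (ii) $C$ has small intervals iff $T$ is increasing; (iii) $C$ is a saturated chain iff $T$ is standard.
   Context: A (binary) path of length $|P|=n$ is a word $P=p_1\cdots p_n$ in the letters $u$ (upstep $(1,1)$) and $d$ (downstep $(1,-1)$), viewed as a lattice path starting at the origin $(0,0)$. $\mathcal{P}_n$ is the set of paths of length $n$. $h_i(P)$ is the height ($y$-coordinate) of the $i$-th point of $P$ (after $i$ steps). $\mathcal{P}_n$ is partially ordered by $P\le Q$ iff $h_i(P)\le h_i(Q)$ for all $1\le i\le n$; this is a finite distributive lattice with maximum $\mathbf{1}_n=u^n$. A valley of $P$ is the last point of a maximal run of consecutive $d$'s: either the middle point of an occurrence of $du$, or the final point of $P$ if $P$ ends with $d$. Turning a valley into a peak means replacing the corresponding $du$ by $ud$, or replacing the final $d$ by $u$ if the valley is the final point. $Q$ covers $P$ iff $Q$ is obtained from $P$ by turning exactly one valley into a peak. A $P-\mathbf{1}_n$ multichain of length $k$ is a sequence $P=P_0\le P_1\le\cdots\le P_k=\mathbf{1}_n$ in $\mathcal{P}_n$; it is a chain if all inequalities are strict, and a saturated chain if moreover each $P_i$ covers $P_{i-1}$. It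 has small intervals if for every $i\in\{1,\dots,k\}$ the path $P_i$ is obtained by (simultaneously) turning some (possibly none) of the valleys of $P_{i-1}$ into peaks. Let $m=|P|_d$ be the number of $d$'s in $P$ and, for $1\le i\le m$, let $k_i$ be the number of $u$'s before the $i$-th $d$ of $P$. Then $\lambda(P)=(\lambda_1,\dots,\lambda_m)$ with $\lambda_i=n-i-k_i+1$; this is a strictly decreasing sequence of positive integers (a strict partition). The shifted diagram of shape $\lambda=(\lambda_1,\dots,\lambda_m)$ is the set of cells $\{(i,j):1\le i\le m,\ i\le j\le\lambda_i+i-1\}$. A shifted tableau $T=(t_{i,j})$ of shape $\lambda$ is a filling of these cells with positive integers that is non-decreasing along rows (as $j$ increases) and along columns (as $i$ increases); $\max(T)$ is its maximum entry. $T$ is increasing if its entries are strictly increasing along rows and columns, and standard if moreover every number in $\{1,\dots,\lambda_1+\cdots+\lambda_m\}$ appears exactly once in $T$.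
   Formalization: Part (iii) is proved as "C is a saturated chain iff T is standard and max(T)=k"; without max(T)=k it fails for k larger than the number of cells of λ(P), e.g. P=d, k=2, T=(1); for all smaller or equal k the two versions agree. *)

theory Defs
  imports Main "HOL-Library.FuncSet"
begin

datatype step = U | D

type_synonym path = "step list"

definition paths :: "nat \<Rightarrow> path set" where
  "paths n = {P. length P = n}"

definition top_path :: "nat \<Rightarrow> path" where
  "top_path n = replicate n U"

fun rise :: "step \<Rightarrow> int" where
  "rise U = 1"
| "rise D = -1"

text \<open>The height of the point reached after \<open>i\<close> steps.\<close>

definition height :: "path \<Rightarrow> nat \<Rightarrow> int" where
  "height P i = sum_list (map rise (take i P))"

definition path_le :: "path \<Rightarrow> path \<Rightarrow> bool" where
  "path_le P Q \<longleftrightarrow>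
     length P = length Q \<and> (\<forall>i\<in>{1..length P}. height P i \<le> height Q i)"

definition path_less :: "path \<Rightarrow> path \<Rightarrow> bool" where
  "path_less P Q \<longleftrightarrow> path_le P Q \<and> P \<noteq> Q"

text \<open>
  A valley is represented by the number \<open>i\<close> of steps leading to it.  In the 0-based
  indexing of lists, the step ending at point \<open>i\<close> is \<open>P ! (i - 1)\<close> and the step starting
  there is \<open>P ! i\<close>.
\<close>

definition valleys :: "path \<Rightarrow> nat set" where
  "valleys P =
     {i \<in> {1..length P}. P ! (i - 1) = D \<and> (i < length P \<longrightarrow> P ! i = U)}"

text \<open>
  Simultaneously turn all valleys in \<open>S\<close> into peaks (used only for \<open>S \<subseteq> valleys P\<close>):
  the step ending at a valley of \<open>S\<close> becomes an upstep, the step starting there (if any) a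
  downstep.  No step is of both kinds, since two valleys are never consecutive points.
\<close>

definition turn_valleys :: "path \<Rightarrow> nat set \<Rightarrow> path" where
  "turn_valleys P S =
     map (\<lambda>j. if Suc j \<in> S then U else if j \<in> S then D else P ! j) [0..<length P]"

definition covers :: "path \<Rightarrow> path \<Rightarrow> bool" where
  "covers Q P \<longleftrightarrow> (\<exists>i\<in>valleys P. Q = turn_valleys P {i})"

text \<open>A multichain \<open>P\<^sub>0 \<le> \<dots> \<le> P\<^sub>k\<close> of length \<open>k\<close> is the list \<open>[P\<^sub>0, \<dots>, P\<^sub>k]\<close> of \<open>k + 1\<close> paths.\<close>

definition multichains :: "nat \<Rightarrow> path \<Rightarrow> path \<Rightarrow> nat \<Rightarrow> path list set" where
  "multichains n P Q k =
     {C. length C = k + 1 \<and> set C \<subseteq> paths n \<and> C ! 0 = P \<and> C ! k = Q \<and>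
         (\<forall>i\<in>{1..k}. path_le (C ! (i - 1)) (C ! i))}"

definition is_chain :: "path list \<Rightarrow> bool" where
  "is_chain C \<longleftrightarrow> (\<forall>i\<in>{1..<length C}. path_less (C ! (i - 1)) (C ! i))"

definition is_saturated_chain :: "path list \<Rightarrow> bool" where
  "is_saturated_chain C \<longleftrightarrow>
     is_chain C \<and> (\<forall>i\<in>{1..<length C}. covers (C ! i) (C ! (i - 1)))"

definition has_small_intervals :: "path list \<Rightarrow> bool" where
  "has_small_intervals C \<longleftrightarrow>
     (\<forall>i\<in>{1..<length C}.
        \<exists>S. S \<subseteq> valleys (C ! (i - 1)) \<and> C ! i = turn_valleys (C ! (i - 1)) S)"

definition down_count :: "path \<Rightarrow> nat" where
  "down_count P = count_list P D"

text \<open>The number of upsteps before the \<open>i\<close>-th downstep, for \<open>1 \<le> i \<le> down_count P\<close>.\<close>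

definition ups_before :: "path \<Rightarrow> nat \<Rightarrow> nat" where
  "ups_before P i =
     (let ds = filter (\<lambda>j. P ! j = D) [0..<length P]
      in count_list (take (ds ! (i - 1)) P) U)"

text \<open>
  The strict partition of a path, as the list of its parts.  The subtractions do not truncate:
  \<open>i + ups_before P i\<close> is the (1-based) position of the \<open>i\<close>-th downstep, which is at most
  \<open>length P\<close>.
\<close>

definition partition_of :: "path \<Rightarrow> nat list" where
  "partition_of P = map (\<lambda>i. length P - i - ups_before P i + 1) [1..<down_count P + 1]"

text \<open>The part \<open>\<lambda>\<^sub>i\<close> of the 1-based mathematical notation is the list entry \<open>l ! (i - 1)\<close>.\<close>

definition shifted_diagram :: "nat list \<Rightarrow> (nat \<times> nat) set" where
  "shifted_diagram l =
     {(i, j). 1 \<le> i \<and> i \<le> length l \<and> i \<le> j \<and> j \<le> l ! (i - 1) + i - 1}"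

text \<open>Fillings are extensional, so that they are determined by their entries in the diagram.\<close>

definition shifted_tableaux :: "nat list \<Rightarrow> (nat \<times> nat \<Rightarrow> nat) set" where
  "shifted_tableaux l =
     {T \<in> shifted_diagram l \<rightarrow>\<^sub>E {1..}.
        (\<forall>i j j'. (i, j) \<in> shifted_diagram l \<and> (i, j') \<in> shifted_diagram l \<and> j < j'
            \<longrightarrow> T (i, j) \<le> T (i, j')) \<and>
        (\<forall>i i' j. (i, j) \<in> shifted_diagram l \<and> (i', j) \<in> shifted_diagram l \<and> i < i'
            \<longrightarrow> T (i, j) \<le> T (i', j))}"

definition entries :: "nat list \<Rightarrow> (nat \<times> nat \<Rightarrow> nat) \<Rightarrow> nat set" where
  "entries l T = T ` shifted_diagram l"

definition max_entry :: "nat list \<Rightarrow> (nat \<times> nat \<Rightarrow> nat) \<Rightarrow> nat" where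
  "max_entry l T = Max (entries l T)"

definition is_increasing_tableau :: "nat list \<Rightarrow> (nat \<times> nat \<Rightarrow> nat) \<Rightarrow> bool" where
  "is_increasing_tableau l T \<longleftrightarrow>
     T \<in> shifted_tableaux l \<and>
     (\<forall>i j j'. (i, j) \<in> shifted_diagram l \<and> (i, j') \<in> shifted_diagram l \<and> j < j'
         \<longrightarrow> T (i, j) < T (i, j')) \<and>
     (\<forall>i i' j. (i, j) \<in> shifted_diagram l \<and> (i', j) \<in> shifted_diagram l \<and> i < i'
         \<longrightarrow> T (i, j) < T (i', j))"

text \<open>
  The maximum entry of a standard tableau of nonempty shape is \<open>sum_list l\<close>.  Such a tableau
  corresponds to a saturated chain of length \<open>k\<close> only if its maximum is \<open>k\<close>, not merely at most
  \<open>k\<close>: all saturated chains from \<open>P\<close> to the top have the same length.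
\<close>

definition is_standard_tableau :: "nat list \<Rightarrow> (nat \<times> nat \<Rightarrow> nat) \<Rightarrow> bool" where
  "is_standard_tableau l T \<longleftrightarrow>
     is_increasing_tableau l T \<and>
     (\<forall>v\<in>{1..sum_list l}. \<exists>!c. c \<in> shifted_diagram l \<and> T c = v)"

text \<open>
  The relation \<^const>\<open>covers\<close> is the covering relation of the poset of paths.
\<close>

lemma height_0 [simp]: "height P 0 = 0"
  by (simp add: height_def)

lemma height_Suc: "i < length P \<Longrightarrow> height P (Suc i) = height P i + rise (P ! i)"
  by (simp add: height_def take_Suc_conv_app_nth)

lemma rise_cases: "rise s = 1 \<and> s = U \<or> rise s = -1 \<and> s = D"
  by (cases s) auto

lemma path_eqI:
  assumes "length P = length Q" "\<And>i. i \<le> length P \<Longrightarrow> height P i = height Q i"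
  shows "P = Q"
proof (rule nth_equalityI)
  fix i assume i: "i < length P"
  have "rise (P ! i) = rise (Q ! i)"
    using assms(2)[of "Suc i"] assms(2)[of i] height_Suc[of i P] height_Suc[of i Q] i assms(1)
    by simp
  then show "P ! i = Q ! i"
    using rise_cases[of "P ! i"] rise_cases[of "Q ! i"] by auto
qed (fact assms(1))

lemma height_parity:
  assumes "length P = length Q" "i \<le> length P"
  shows "even (height P i - height Q i)"
  using assms(2)
proof (induction i)
  case (Suc i)
  then show ?case
    using height_Suc[of i P] height_Suc[of i Q] assms(1)
      rise_cases[of "P ! i"] rise_cases[of "Q ! i"]
    by auto
qed simp

lemma even_gap:
  "even (a - b) \<Longrightarrow> b \<le> a \<Longrightarrow> a \<le> b + 2 \<Longrightarrow> a = b \<or> a = b + 2" for a b :: int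
  by presburger

lemma path_leD: "path_le P Q \<Longrightarrow> i \<le> length P \<Longrightarrow> height P i \<le> height Q i"
  by (cases i) (auto simp: path_le_def)

lemma height_turn_valley:
  assumes "i \<in> valleys P" "j \<le> length P"
  shows "height (turn_valleys P {i}) j = height P j + (if j = i then 2 else 0)"
  using assms(2)
proof (induction j)
  case 0
  then show ?case using assms(1) by (auto simp: valleys_def)
next
  case (Suc j)
  have len: "length (turn_valleys P {i}) = length P"
    by (simp add: turn_valleys_def)
  have "turn_valleys P {i} ! j = (if Suc j = i then U else if j = i then D else P ! j)"
    using Suc.prems by (simp add: turn_valleys_def)
  moreover have "P ! j = D" if "Suc j = i"
    using assms(1) that[symmetric] by (auto simp: valleys_def)
  moreover have "P ! j = U" if "j = i"
    using assms(1) that Suc.prems by (auto simp: valleys_def)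
  ultimately show ?case
    using Suc height_Suc[of j P] height_Suc[of j "turn_valleys P {i}"] len
    by (cases "Suc j = i"; cases "j = i") auto
qed

lemma covers_iff:
  "covers Q P \<longleftrightarrow> path_less P Q \<and> (\<nexists>R. path_less P R \<and> path_less R Q)"
proof
  assume "covers Q P"
  then obtain i where i: "i \<in> valleys P" and Q: "Q = turn_valleys P {i}"
    by (auto simp: covers_def)
  have len: "length Q = length P"
    by (simp add: Q turn_valleys_def)
  have h: "height Q j = height P j + (if j = i then 2 else 0)" if "j \<le> length P" for j
    using height_turn_valley[OF i that] Q by simp
  have i_le: "i \<le> length P"
    using i by (simp add: valleys_def)
  have "P \<noteq> Q"
    using h[OF i_le] by auto
  then have "path_less P Q"
    using h len by (auto simp: path_less_def path_le_def)
  moreover have False if "path_less P R" "path_less R Q" for R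
  proof -
    have lR: "length R = length P" and PR: "P \<noteq> R" and RQ: "R \<noteq> Q"
      and le: "path_le P R" "path_le R Q"
      using that by (auto simp: path_less_def path_le_def)
    have b: "height P j \<le> height R j \<and> height R j \<le> height P j + (if j = i then 2 else 0)"
      if "j \<le> length P" for j
      using path_leD[OF le(1) that] path_leD[OF le(2), of j] that lR h[OF that] by simp
    have e: "even (height R i - height P i)"
      using height_parity[of R P i] lR i_le by simp
    then consider "height R i = height P i" | "height R i = height P i + 2"
      using b[OF i_le] even_gap[of "height R i" "height P i"] by auto
    then show False
    proof cases
      case 1
      have "P = R"
      proof (rule path_eqI)
        show "height P j = height R j" if "j \<le> length P" for j
          using b[OF that] 1 by (auto split: if_splits)
      qed (simp add: lR)
      then show False using PR by simp
    next
      case 2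
      have "R = Q"
      proof (rule path_eqI)
        show "height R j = height Q j" if "j \<le> length R" for j
          using b[of j] h[of j] 2 that lR by (auto split: if_splits)
      qed (simp add: lR len)
      then show False using RQ by simp
    qed
  qed
  ultimately show "path_less P Q \<and> (\<nexists>R. path_less P R \<and> path_less R Q)"
    by blast
next
  assume *: "path_less P Q \<and> (\<nexists>R. path_less P R \<and> path_less R Q)"
  then have le: "path_le P Q" and ne: "P \<noteq> Q" and len: "length Q = length P"
    by (auto simp: path_less_def path_le_def)
  define A where "A = {i. i \<le> length P \<and> height P i < height Q i}"
  have "\<exists>i. i \<in> A"
  proof (rule ccontr)
    assume "\<not> (\<exists>i. i \<in> A)"
    then have "height P i = height Q i" if "i \<le> length P" for i
      using path_leD[OF le that] that by (force simp: A_def)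
    then show False using path_eqI[of P Q] len ne by simp
  qed
  moreover have "finite A"
    by (simp add: A_def)
  ultimately obtain i where iA: "i \<in> A" and min: "\<And>j. j \<in> A \<Longrightarrow> height P i \<le> height P j"
    using ex_min_if_finite[of "height P ` A"] by (force simp: not_less)
  have i_le: "i \<le> length P" and i_lt: "height P i < height Q i"
    using iA by (auto simp: A_def)
  then have i_pos: "i \<noteq> 0"
    by (metis height_0 less_irrefl)
  then obtain i' where i': "i = Suc i'"
    by (cases i) auto
  have "P ! i' = D"
  proof (rule ccontr)
    assume "P ! i' \<noteq> D"
    then have "height P i = height P i' + 1"
      using height_Suc[of i' P] rise_cases[of "P ! i'"] i_le i' by auto
    moreover have "height Q i \<le> height Q i' + 1"
      using height_Suc[of i' Q] rise_cases[of "Q ! i'"] i_le i' len by auto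
    ultimately show False
      using min[of i'] i_lt i_le i' by (auto simp: A_def)
  qed
  moreover have "P ! i = U" if "i < length P"
  proof (rule ccontr)
    assume "P ! i \<noteq> U"
    then have "height P (Suc i) = height P i - 1"
      using height_Suc[of i P] rise_cases[of "P ! i"] that by auto
    moreover have "height Q (Suc i) \<ge> height Q i - 1"
      using height_Suc[of i Q] rise_cases[of "Q ! i"] that len by auto
    ultimately show False
      using min[of "Suc i"] i_lt that by (auto simp: A_def)
  qed
  ultimately have val: "i \<in> valleys P"
    using i_le i' by (simp add: valleys_def)
  define R where "R = turn_valleys P {i}"
  have lR: "length R = length P"
    by (simp add: R_def turn_valleys_def)
  have h: "height R j = height P j + (if j = i then 2 else 0)" if "j \<le> length P" for j
    using height_turn_valley[OF val that] R_def by simp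
  have "P \<noteq> R"
    using h[OF i_le] by auto
  then have "path_less P R"
    using h lR by (auto simp: path_less_def path_le_def)
  moreover have "height P i + 2 \<le> height Q i"
    using height_parity[of Q P i] len i_le i_lt even_gap[of "height Q i" "height P i"]
    by force
  then have "path_le R Q"
    using h lR len path_leD[OF le] by (auto simp: path_le_def)
  ultimately have "R = Q"
    using * by (auto simp: path_less_def)
  then show "covers Q P"
    using val R_def by (auto simp: covers_def)
qed

end

theory Submission imports Defs begin

text \<open>
  Two descriptions of a path are matched throughout: its downstep counts, which control the
  order and the valleys, and the cells of its shifted diagram.  The bridge is
  \<open>mem_cells_iff\<close>: for a path of length \<open>n\<close>, the cells \<open>(i, j)\<close> with \<open>j - i = n - x\<close> form a diagonal of the
  plane, and the diagram contains exactly the first \<open>d\<close> of them, where \<open>d\<close> is the number of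
  downsteps among the first \<open>x\<close> steps.  Consequently \<open>P \<le> Q\<close> holds iff the
  diagram of \<open>Q\<close> is contained in that of \<open>P\<close> (\<open>cells_subset_iff\<close>), and every order
  ideal of the staircase is the diagram of a unique path (\<open>cells_inject\<close>,
  \<open>ex_path_of_order_ideal\<close>).  The top path has the empty diagram.

  A multichain from \<open>P\<close> to the top is therefore a decreasing sequence of order ideals which
  starts with the diagram of \<open>P\<close> and ends with the empty set.  Writing into each cell the time at
  which it disappears, counted backwards from \<open>k\<close>, gives a filling whose sublevel sets are the
  ideals of the sequence; it is weakly monotone because these are order ideals, and conversely the
  sublevel sets of a tableau are order ideals and so come from a multichain.  This is the bijection.

  The three equivalences are read off one step at a time, since the cells with a given entry are
  those removed in one step of the multichain.  A step is strict iff it removes at least one cell, and a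
  cover iff it removes exactly one (\<open>covers_iff_single_cell\<close>).  It turns a set of
  valleys iff no two removed cells share a row or a column (\<open>turn_valleys_iff\<close>); for a
  weakly monotone filling this says precisely that the rows and columns increase strictly.
\<close>

section \<open>Paths through their downstep counts\<close>

definition downs :: "path \<Rightarrow> nat \<Rightarrow> nat" where
  "downs P x = count_list (take x P) D"

lemma downs_0 [simp]: "downs P 0 = 0"
  by (simp add: downs_def)

lemma downs_Suc:
  "x < length P \<Longrightarrow> downs P (Suc x) = downs P x + (if P ! x = D then 1 else 0)"
  by (simp add: downs_def take_Suc_conv_app_nth)

lemma downs_length: "downs P (length P) = down_count P"
  by (simp add: downs_def down_count_def)

lemma downs_Suc_bounds: "downs P x \<le> downs P (Suc x) \<and> downs P (Suc x) \<le> Suc (downs P x)"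
  using downs_Suc[of x P] by (cases "x < length P") (auto simp: downs_def)

lemma downs_bounds:
  assumes "x \<le> y"
  shows "downs P x \<le> downs P y" "downs P y \<le> downs P x + (y - x)"
proof -
  have "downs P x \<le> downs P y \<and> downs P y \<le> downs P x + (y - x)"
    using assms
  proof (induction y rule: dec_induct)
    case (step y)
    then show ?case using downs_Suc_bounds[of P y] by auto
  qed simp
  then show "downs P x \<le> downs P y" "downs P y \<le> downs P x + (y - x)" by auto
qed

lemma downs_le: "downs P x \<le> x"
  using downs_bounds(2)[of 0 x P] by simp

lemma height_eq_downs: "x \<le> length P \<Longrightarrow> height P x = int x - 2 * int (downs P x)"
proof (induction x)
  case (Suc x)
  then show ?case
    using height_Suc[of x P] downs_Suc[of x P] rise_cases[of "P ! x"] by auto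
qed simp

lemma path_eqI_downs:
  assumes "length P = length Q" "\<And>x. x \<le> length P \<Longrightarrow> downs P x = downs Q x"
  shows "P = Q"
  using assms by (intro path_eqI) (auto simp: height_eq_downs)

lemma path_le_iff_downs:
  assumes "length P = length Q"
  shows "path_le P Q \<longleftrightarrow> (\<forall>x\<le>length P. downs Q x \<le> downs P x)"
proof
  assume "path_le P Q"
  then show "\<forall>x\<le>length P. downs Q x \<le> downs P x"
    using path_leD[of P Q] assms by (fastforce simp: height_eq_downs)
next
  assume "\<forall>x\<le>length P. downs Q x \<le> downs P x"
  then show "path_le P Q"
    using assms by (auto simp: path_le_def height_eq_downs)
qed

lemma downs_top_path: "downs (top_path n) x = 0"
  by (simp add: downs_def top_path_def)

text \<open>Downstep counts are free apart from growing by at most one per step, so a path can be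
  prescribed by its counts.\<close>

lemma ex_path_downs:
  assumes "e 0 = 0" "\<And>x. x < n \<Longrightarrow> e x \<le> e (Suc x) \<and> e (Suc x) \<le> Suc (e x)"
  shows "\<exists>P. length P = n \<and> (\<forall>x\<le>n. downs P x = e x)"
proof -
  define P where "P = map (\<lambda>x. if e (Suc x) = e x then U else D) [0..<n]"
  have len: "length P = n" by (simp add: P_def)
  have "downs P x = e x" if "x \<le> n" for x
    using that
  proof (induction x)
    case (Suc x)
    then show ?case
      using assms(2)[of x] downs_Suc[of x P] len by (auto simp: P_def)
  qed (simp add: assms)
  with len show ?thesis by blast
qed

section \<open>The diagram of a path\<close>

abbreviation cells :: "path \<Rightarrow> (nat \<times> nat) set" where
  "cells P \<equiv> shifted_diagram (partition_of P)"

abbreviation down_positions :: "path \<Rightarrow> nat list" where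
  "down_positions P \<equiv> filter (\<lambda>j. P ! j = D) [0..<length P]"

lemma down_positions_snoc:
  "down_positions (P @ [s]) = down_positions P @ (if s = D then [length P] else [])"
proof -
  have "filter (\<lambda>j. (P @ [s]) ! j = D) [0..<length P] = down_positions P"
    by (rule filter_cong) (auto simp: nth_append)
  then show ?thesis by simp
qed

lemma length_down_positions: "length (down_positions P) = down_count P"
proof (induction P rule: rev_induct)
  case (snoc s P)
  then show ?case by (simp only: down_positions_snoc) (simp add: down_count_def)
qed (simp add: down_count_def)

text \<open>Prefixes of a path do not change when it is prolonged, so adding the last step is the
  convenient direction of induction.\<close>

lemma downs_down_positions:
  "i < down_count P \<Longrightarrow> downs P (down_positions P ! i) = i"
proof (induction P rule: rev_induct)
  case (snoc s P)
  show ?case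
  proof (cases "i < down_count P")
    case True
    then have "down_positions P ! i < length P"
      using nth_mem[of i "down_positions P"] by (auto simp: length_down_positions)
    then show ?thesis
      using True snoc.IH
      by (simp only: down_positions_snoc)
         (simp add: nth_append length_down_positions downs_def)
  next
    case False
    then have "s = D" "i = down_count P"
      using snoc.prems by (auto simp: down_count_def split: if_splits)
    then show ?thesis
      by (simp only: down_positions_snoc)
         (simp add: nth_append length_down_positions downs_def down_count_def)
  qed
qed (simp add: down_count_def)

lemma downs_plus_ups: "x \<le> length P \<Longrightarrow> downs P x + count_list (take x P) U = x"
proof (induction x)
  case (Suc x)
  then show ?case
    using downs_Suc[of x P] rise_cases[of "P ! x"]
    by (auto simp: take_Suc_conv_app_nth)
qed simp

text \<open>If the downstep of index \<open>i\<close> has position \<open>p\<close>, then \<open>p - i\<close> upsteps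
  precede it, and the two occurrences of \<open>i\<close> in the definition of the part cancel.\<close>

lemma nth_partition_of:
  assumes "i < down_count P"
  shows "partition_of P ! i = length P - down_positions P ! i"
proof -
  let ?p = "down_positions P ! i"
  have p: "?p < length P"
    using nth_mem[of i "down_positions P"] assms by (auto simp: length_down_positions)
  have "ups_before P (Suc i) = count_list (take ?p P) U"
    by (simp add: ups_before_def)
  moreover have "i + count_list (take ?p P) U = ?p"
    using downs_plus_ups[of ?p P] downs_down_positions[OF assms] p by simp
  ultimately show ?thesis
    using assms p by (simp add: partition_of_def del: upt_Suc)
qed

text \<open>
  By the formula for its parts, row \<open>i\<close> of the diagram reaches column \<open>j\<close> iff the
  \<open>i\<close>-th downstep lies among the first \<open>n - (j - i)\<close> steps, that is, iff these contain at
  least \<open>i\<close> downsteps.  For \<open>j - i > n\<close> the truncated difference is \<open>0\<close>, and both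
  sides are false.
\<close>

lemma mem_cells_iff:
  "(i, j) \<in> cells P \<longleftrightarrow> 1 \<le> i \<and> i \<le> j \<and> i \<le> downs P (length P - (j - i))"
proof (cases "1 \<le> i \<and> i \<le> j \<and> i \<le> down_count P")
  case True
  then obtain i' where i: "i = Suc i'" and i': "i' < down_count P"
    by (cases i) auto
  define p x where "p = down_positions P ! i'" and "x = length P - (j - i)"
  have p: "p < length P" "P ! p = D"
    using nth_mem[of i' "down_positions P"] i' by (auto simp: length_down_positions p_def)
  have dp: "downs P p = i'"
    using downs_down_positions[OF i'] by (simp add: p_def)
  have "(i, j) \<in> cells P \<longleftrightarrow> j \<le> length P - p + i - 1"
    using True i nth_partition_of[OF i']
    by (simp add: shifted_diagram_def partition_of_def p_def del: upt_Suc)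
  also have "\<dots> \<longleftrightarrow> p < x"
    using True p(1) i by (auto simp: x_def)
  also have "\<dots> \<longleftrightarrow> i \<le> downs P x"
    using downs_bounds(1)[of "Suc p" x P] downs_bounds(1)[of x p P] downs_Suc[OF p(1)] p(2) dp i
    by (cases "p < x") auto
  finally show ?thesis using True by (simp add: x_def)
next
  case False
  moreover have "downs P (length P - (j - i)) \<le> down_count P"
    unfolding downs_length[symmetric] by (rule downs_bounds) simp
  ultimately show ?thesis
    by (auto simp: shifted_diagram_def partition_of_def simp del: upt_Suc)
qed

text \<open>Comparing two diagrams amounts to comparing, diagonal by diagonal, two initial segments.\<close>

lemma cells_subset_iff:
  assumes "length P = length Q"
  shows "cells Q \<subseteq> cells P \<longleftrightarrow> path_le P Q"
  unfolding path_le_iff_downs[OF assms]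
proof
  assume sub: "cells Q \<subseteq> cells P"
  show "\<forall>x\<le>length P. downs Q x \<le> downs P x"
  proof (intro allI impI)
    fix x assume x: "x \<le> length P"
    show "downs Q x \<le> downs P x"
    proof (cases "downs Q x = 0")
      case False
      then have "(downs Q x, downs Q x + (length P - x)) \<in> cells Q"
        using x assms by (simp add: mem_cells_iff)
      then have "(downs Q x, downs Q x + (length P - x)) \<in> cells P"
        using sub by blast
      then show ?thesis using x by (simp add: mem_cells_iff)
    qed simp
  qed
next
  assume "\<forall>x\<le>length P. downs Q x \<le> downs P x"
  then have "downs Q (length Q - m) \<le> downs P (length P - m)" for m
    using assms by simp
  then show "cells Q \<subseteq> cells P"
    unfolding mem_cells_iff subset_iff split_paired_All by (meson order_trans)
qed

lemma cells_inject:
  assumes "length P = length Q" "cells P = cells Q"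
  shows "P = Q"
proof -
  have "path_le P Q" "path_le Q P"
    using cells_subset_iff[of P Q] cells_subset_iff[of Q P] assms by auto
  then show ?thesis
    using assms(1) by (intro path_eqI_downs) (auto simp: path_le_iff_downs intro: antisym)
qed

lemma cells_top_path: "cells (top_path n) = {}"
  by (auto simp: mem_cells_iff downs_top_path)

text \<open>The next two lemmas say that a diagram is an order ideal.  A step to the left enlarges
  the prefix whose downsteps are counted; a step upwards drops one step of the prefix, and with it at
  most one downstep, while lowering the required number by one.\<close>

lemma cells_row_closed:
  assumes "(i, j') \<in> cells P" "i \<le> j" "j \<le> j'"
  shows "(i, j) \<in> cells P"
proof -
  have "downs P (length P - (j' - i)) \<le> downs P (length P - (j - i))"
    using assms(3) by (intro downs_bounds diff_le_mono2 diff_le_mono)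
  then show ?thesis using assms by (auto simp only: mem_cells_iff)
qed

lemma cells_column_closed:
  assumes "(i', j) \<in> cells P" "1 \<le> i" "i \<le> i'"
  shows "(i, j) \<in> cells P"
proof -
  let ?x = "length P - (j - i)" and ?x' = "length P - (j - i')"
  have "downs P ?x' \<le> downs P ?x + (?x' - ?x)"
    using assms by (intro downs_bounds) auto
  moreover have "?x' - ?x \<le> i' - i" using assms by auto
  ultimately show ?thesis using assms by (auto simp: mem_cells_iff)
qed

lemma mem_cells_bounds:
  assumes "(i, j) \<in> cells P"
  shows "1 \<le> i" "i \<le> j" "j \<le> length P"
  using assms downs_le[of P "length P - (j - i)"] by (auto simp: mem_cells_iff)

text \<open>
  On the diagonal \<open>j - i = n - x\<close> an order ideal is an initial segment, because a step up
  followed by a step left moves along the diagonal.  Closure under steps to the left makes the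
  lengths of these segments increase with \<open>x\<close>, and closure under steps upwards makes them grow
  by at most one, so they are the downstep counts of a path.
\<close>

lemma ex_path_of_order_ideal:
  assumes bounds: "\<And>i j. (i, j) \<in> J \<Longrightarrow> 1 \<le> i \<and> i \<le> j \<and> j \<le> n"
    and row: "\<And>i j j'. (i, j') \<in> J \<Longrightarrow> i \<le> j \<Longrightarrow> j \<le> j' \<Longrightarrow> (i, j) \<in> J"
    and column: "\<And>i i' j. (i', j) \<in> J \<Longrightarrow> 1 \<le> i \<Longrightarrow> i \<le> i' \<Longrightarrow> (i, j) \<in> J"
  shows "\<exists>P. length P = n \<and> cells P = J"
proof -
  \<comment> \<open>\<open>A x\<close> collects the row indices on the diagonal that belongs to prefixes of length
    \<open>x\<close>.\<close>
  define A where "A = (\<lambda>x. {i. (i, i + (n - x)) \<in> J})"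
  have A_sub: "A x \<subseteq> {1..x}" if "x \<le> n" for x
    using bounds that by (fastforce simp: A_def)
  have A_down: "i \<in> A x" if "i' \<in> A x" "1 \<le> i" "i \<le> i'" for i i' x
    using row[OF column[of i' "i' + (n - x)" i], of "i + (n - x)"] that by (simp add: A_def)
  have A_eq: "A x = {1..card (A x)}" if "x \<le> n" for x
  proof (cases "A x = {}")
    case False
    have fin: "finite (A x)" using A_sub[OF that] finite_subset by blast
    have "A x = {1..Max (A x)}"
      using A_sub[OF that] A_down[OF Max_in[OF fin False]] fin by fastforce
    then show ?thesis by (metis card_atLeastAtMost diff_Suc_1)
  qed simp
  then have mem_A: "i \<in> A x \<longleftrightarrow> 1 \<le> i \<and> i \<le> card (A x)" if "x \<le> n" for i x
    using that by (metis atLeastAtMost_iff)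
  have "\<exists>P. length P = n \<and> (\<forall>x\<le>n. downs P x = card (A x))"
  proof (rule ex_path_downs)
    show "card (A 0) = 0" using A_sub[of 0] by simp
  next
    fix x assume x: "x < n"
    have "A x \<subseteq> A (Suc x)"
      unfolding A_def by (intro Collect_mono impI, erule row) auto
    then have 1: "card (A x) \<le> card (A (Suc x))"
      using finite_subset[OF A_sub[of "Suc x"]] x by (intro card_mono) auto
    have 2: "card (A (Suc x)) \<le> Suc (card (A x))"
    proof (rule ccontr)
      let ?i = "card (A x)"
      assume "\<not> ?thesis"
      then have "Suc (Suc ?i) \<in> A (Suc x)" using mem_A[of "Suc x"] x by simp
      then have "(Suc (Suc ?i), Suc (Suc ?i) + (n - Suc x)) \<in> J"
        by (simp add: A_def)
      moreover have "Suc (Suc ?i) + (n - Suc x) = Suc ?i + (n - x)"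
        using x by simp
      ultimately have "(Suc (Suc ?i), Suc ?i + (n - x)) \<in> J"
        by (simp only:)
      then have "Suc ?i \<in> A x"
        using column[of "Suc (Suc ?i)" _ "Suc ?i"] by (simp add: A_def)
      then show False using mem_A[of x] x by simp
    qed
    show "card (A x) \<le> card (A (Suc x)) \<and> card (A (Suc x)) \<le> Suc (card (A x))"
      using 1 2 by simp
  qed
  then obtain P where len: "length P = n" and d: "\<And>x. x \<le> n \<Longrightarrow> downs P x = card (A x)"
    by blast
  have "(i, j) \<in> cells P \<longleftrightarrow> (i, j) \<in> J" for i j
  proof (cases "1 \<le> i \<and> i \<le> j \<and> j \<le> n")
    case True
    have "(i, j) \<in> cells P \<longleftrightarrow> 1 \<le> i \<and> i \<le> card (A (n - (j - i)))"
      unfolding mem_cells_iff len using True d[OF diff_le_self, of "j - i"] by simp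
    also have "\<dots> \<longleftrightarrow> i \<in> A (n - (j - i))"
      by (rule mem_A[symmetric]) simp
    also have "\<dots> \<longleftrightarrow> (i, j) \<in> J"
      using True by (simp add: A_def)
    finally show ?thesis .
  next
    case False
    then show ?thesis using bounds mem_cells_bounds[of i j P] len by blast
  qed
  then have "cells P = J" by auto
  with len show ?thesis by blast
qed

section \<open>Turning valleys removes corners\<close>

text \<open>Turning the valley \<open>x\<close> exchanges steps \<open>x\<close> and \<open>x + 1\<close>, or changes the last
  step, so only the prefix of length \<open>x\<close> loses a downstep.\<close>

lemma downs_turn_valleys:
  assumes "S \<subseteq> valleys P" "x \<le> length P"
  shows "downs P x = downs (turn_valleys P S) x + (if x \<in> S then 1 else 0)"
  using assms(2)
proof (induction x)
  case 0
  then show ?case using assms(1) by (auto simp: valleys_def)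
next
  case (Suc x)
  have "length (turn_valleys P S) = length P"
    by (simp add: turn_valleys_def)
  moreover have "turn_valleys P S ! x = (if Suc x \<in> S then U else if x \<in> S then D else P ! x)"
    using Suc.prems by (simp add: turn_valleys_def)
  moreover have "P ! x = D" if "Suc x \<in> S"
    using subsetD[OF assms(1) that] by (simp add: valleys_def)
  moreover have "P ! x = U" if "x \<in> S"
    using subsetD[OF assms(1) that] Suc.prems by (simp add: valleys_def)
  ultimately show ?case
    using Suc downs_Suc[of x P] downs_Suc[of x "turn_valleys P S"]
    by (cases "Suc x \<in> S"; cases "x \<in> S") auto
qed

lemma downs_before_valley: "x \<in> valleys P \<Longrightarrow> downs P x = Suc (downs P (x - 1))"
  using downs_Suc[of "x - 1" P] by (auto simp: valleys_def)

text \<open>Each turned valley removes the last cell of its diagonal.\<close>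

lemma cells_turn_valleys:
  assumes S: "S \<subseteq> valleys P"
  shows "cells P - cells (turn_valleys P S) =
           (\<lambda>x. (downs P x, downs P x + (length P - x))) ` S" (is "?L = ?R")
proof
  have len: "length (turn_valleys P S) = length P"
    by (simp add: turn_valleys_def)
  show "?L \<subseteq> ?R"
  proof clarify
    fix i j assume c: "(i, j) \<in> cells P" "(i, j) \<notin> cells (turn_valleys P S)"
    let ?x = "length P - (j - i)"
    have "?x \<in> S" "i = downs P ?x"
      using c downs_turn_valleys[OF S, of ?x] len by (auto simp: mem_cells_iff split: if_splits)
    moreover have "j = i + (length P - ?x)"
      using mem_cells_bounds[OF c(1)] by simp
    ultimately show "(i, j) \<in> ?R" by (metis (no_types, lifting) image_eqI)
  qed
  show "?R \<subseteq> ?L"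
  proof clarify
    fix x assume x: "x \<in> S"
    then have "x \<in> valleys P" using S by blast
    then show "(downs P x, downs P x + (length P - x)) \<in> ?L"
      using downs_turn_valleys[OF S, of x] downs_before_valley[of x P] x len
      by (auto simp: mem_cells_iff valleys_def)
  qed
qed

text \<open>
  For two valleys \<open>x < y\<close>, the downstep ending at \<open>y\<close> separates the rows of the removable
  cells.  The upstep leaving \<open>x\<close> separates their columns: up to a constant, the column is the
  negative of the number of upsteps up to the valley.
\<close>

lemma valley_corners_apart:
  assumes "x \<in> valleys P" "y \<in> valleys P" "x < y"
  shows "downs P x < downs P y"
    and "downs P y + (length P - y) < downs P x + (length P - x)"
proof -
  have y: "y \<le> length P" using assms by (simp add: valleys_def)
  show "downs P x < downs P y"
    using downs_before_valley[OF assms(2)] downs_bounds(1)[of x "y - 1" P] assms(3) by linarith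
  have "downs P (Suc x) = downs P x"
    using assms y downs_Suc[of x P] by (auto simp: valleys_def)
  then show "downs P y + (length P - y) < downs P x + (length P - x)"
    using downs_bounds(2)[of "Suc x" y P] assms(3) y by simp
qed

text \<open>
  Turning valleys removes cells in different rows and columns by \<open>valley_corners_apart\<close>.
  Conversely, if the removed cells lie in different rows and columns, then at most the last cell of
  each diagonal is removed.  Where this happens, at \<open>x\<close>, the path must arrive by a downstep
  and leave by an upstep: an upstep before \<open>x\<close> would put the right neighbour of the removed
  cell into the diagram of \<open>P\<close>, a downstep after \<open>x\<close> would do so for its lower neighbour,
  and these would be removed with it.
\<close>

lemma turn_valleys_iff:
  assumes len: "length Q = length P" and sub: "cells Q \<subseteq> cells P"
  shows "(\<exists>S\<subseteq>valleys P. Q = turn_valleys P S) \<longleftrightarrow>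
           inj_on fst (cells P - cells Q) \<and> inj_on snd (cells P - cells Q)"
proof
  assume "\<exists>S\<subseteq>valleys P. Q = turn_valleys P S"
  then obtain S where S: "S \<subseteq> valleys P" "Q = turn_valleys P S" by blast
  have ne: "downs P x \<noteq> downs P y"
      "downs P x + (length P - x) \<noteq> downs P y + (length P - y)"
    if "x \<in> S" "y \<in> S" "x \<noteq> y" for x y
    using valley_corners_apart[of x P y] valley_corners_apart[of y P x] that S(1)
    by (cases "x < y"; force)+
  show "inj_on fst (cells P - cells Q) \<and> inj_on snd (cells P - cells Q)"
    unfolding S(2) cells_turn_valleys[OF S(1)]
    by (intro conjI inj_onI) (auto, (metis ne)+)
next
  assume inj: "inj_on fst (cells P - cells Q) \<and> inj_on snd (cells P - cells Q)"
  have le: "downs Q x \<le> downs P x" if "x \<le> length P" for x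
    using sub that len cells_subset_iff[of P Q] path_le_iff_downs[of P Q] by simp
  define S where "S = {x. x \<le> length P \<and> downs Q x < downs P x}"
  have removed: "(i, i + (length P - x)) \<in> cells P - cells Q"
    if "x \<le> length P" "downs Q x < i" "i \<le> downs P x" for i x
    using that len by (simp add: mem_cells_iff)
  have row: False
    if "x < y" "y \<le> length P" "downs Q x < i" "i \<le> downs P x" "downs Q y < i" "i \<le> downs P y"
    for i x y
    using inj_onD[OF inj[THEN conjunct1] _ removed[of x i] removed[of y i]] that by simp
  have one: "downs P x \<le> downs Q x + 1" if x: "x \<le> length P" for x
  proof (rule ccontr)
    assume far: "\<not> ?thesis"
    then have "0 < x" by (cases x) auto
    \<comment> \<open>Since a step changes the count by at most one, the last cell but one of
      the diagonal of \<open>P\<close> and its right neighbour are both removed.\<close>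
    then show False
      using far downs_Suc_bounds[of P "x - 1"] downs_Suc_bounds[of Q "x - 1"] x
      by (intro row[of "x - 1" x "downs P x - 1"]) auto
  qed
  have val: "x \<in> valleys P" if "x \<in> S" for x
  proof -
    have x: "x \<le> length P" "downs P x = Suc (downs Q x)"
      using that one[of x] by (auto simp: S_def)
    then have "0 < x" by (cases x) auto
    have "P ! (x - 1) = D"
    proof (rule ccontr)
      assume "P ! (x - 1) \<noteq> D"
      then have "downs P (x - 1) = downs P x"
        using downs_Suc[of "x - 1" P] x \<open>0 < x\<close> by simp
      then show False
        using row[of "x - 1" x "downs P x"] x \<open>0 < x\<close> downs_Suc_bounds[of Q "x - 1"] by simp
    qed
    moreover have "P ! x = U" if "x < length P"
    proof (rule ccontr)
      assume "P ! x \<noteq> U"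
      then have "P ! x = D" using rise_cases[of "P ! x"] by auto
      then have d: "downs P (Suc x) = Suc (downs P x)"
        using downs_Suc[of x P] that by simp
      let ?i = "downs P x"
      have "(?i, ?i + (length P - x)) \<in> cells P - cells Q"
        using removed[of x ?i] x by simp
      moreover have "Suc ?i + (length P - Suc x) = ?i + (length P - x)"
        using that by simp
      then have "(Suc ?i, ?i + (length P - x)) \<in> cells P - cells Q"
        using removed[of "Suc x" "Suc ?i"] x that d downs_Suc_bounds[of Q x] by simp
      ultimately show False
        using inj_onD[OF inj[THEN conjunct2], of "(?i, ?i + (length P - x))"
            "(Suc ?i, ?i + (length P - x))"] by simp
    qed
    ultimately show ?thesis using x(1) \<open>0 < x\<close> by (simp add: valleys_def)
  qed
  then have S: "S \<subseteq> valleys P" by blast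
  have "Q = turn_valleys P S"
  proof (rule path_eqI_downs)
    show "length Q = length (turn_valleys P S)" by (simp add: len turn_valleys_def)
    show "downs Q x = downs (turn_valleys P S) x" if "x \<le> length Q" for x
      using downs_turn_valleys[OF S, of x] le[of x] one[of x] that len
      by (auto simp: S_def split: if_splits)
  qed
  with S show "\<exists>S\<subseteq>valleys P. Q = turn_valleys P S" by blast
qed

text \<open>If one cell is removed, there is no room for a path strictly in between, since paths
  are determined by their cells; so the description of covers by the order applies.\<close>

lemma covers_iff_single_cell:
  assumes len: "length Q = length P" and sub: "cells Q \<subseteq> cells P"
  shows "covers Q P \<longleftrightarrow> (\<exists>c. cells P - cells Q = {c})"
proof
  assume "covers Q P"
  then obtain x where "x \<in> valleys P" "Q = turn_valleys P {x}"
    by (auto simp: covers_def)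
  then show "\<exists>c. cells P - cells Q = {c}"
    using cells_turn_valleys[of "{x}" P] by auto
next
  assume c: "\<exists>c. cells P - cells Q = {c}"
  then have "path_less P Q"
    using cells_subset_iff[of P Q] len sub by (auto simp: path_less_def)
  moreover have False if R: "path_less P R" "path_less R Q" for R
  proof -
    have lR: "length R = length P" and ne: "P \<noteq> R" "R \<noteq> Q"
      using R by (auto simp: path_less_def path_le_def)
    have "cells R \<subseteq> cells P" "cells Q \<subseteq> cells R"
      using R cells_subset_iff[of P R] cells_subset_iff[of R Q] lR len
      by (auto simp: path_less_def)
    moreover obtain c where "cells P - cells Q = {c}" using c by blast
    ultimately have "cells R = cells P \<or> cells R = cells Q"
      by (cases "c \<in> cells R") auto
    then show False using cells_inject[of R P] cells_inject[of R Q] ne lR len by auto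
  qed
  ultimately show "covers Q P" unfolding covers_iff by blast
qed

section \<open>The tableau of a multichain\<close>

text \<open>
  Diagrams shrink along a multichain and lose their outer cells first, whereas the entries of a
  tableau are largest there; hence the time is counted from the end of the multichain.
  The first path of \<open>C\<close> supplies the shape on which the filling is extensional.
\<close>

definition chain_tableau :: "nat \<Rightarrow> path list \<Rightarrow> nat \<times> nat \<Rightarrow> nat" where
  "chain_tableau k C = (\<lambda>c\<in>cells (C ! 0). LEAST s. c \<in> cells (C ! (k - s)))"

lemma shifted_diagram_Sigma:
  "shifted_diagram l = (SIGMA i:{1..length l}. {i..<i + l ! (i - 1)})"
  by (auto simp: shifted_diagram_def)

lemma finite_shifted_diagram: "finite (shifted_diagram l)"
  by (simp add: shifted_diagram_Sigma)

lemma card_shifted_diagram: "card (shifted_diagram l) = sum_list l"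
proof -
  have "card (shifted_diagram l) = (\<Sum>i=1..length l. l ! (i - 1))"
    by (simp add: shifted_diagram_Sigma)
  also have "\<dots> = (\<Sum>i=0..<length l. l ! i)"
    by (rule sum.reindex_bij_witness[of _ Suc "\<lambda>i. i - 1"]) auto
  finally show ?thesis by (simp add: sum_list_sum_nth)
qed

context
  fixes n k :: nat and P :: path and C :: "path list"
  assumes C: "C \<in> multichains n P (top_path n) k"
begin

lemma multichain_length: "t \<le> k \<Longrightarrow> length (C ! t) = n"
proof -
  assume "t \<le> k"
  then have "C ! t \<in> set C" "set C \<subseteq> paths n"
    using C by (auto simp: multichains_def)
  then show "length (C ! t) = n" by (auto simp: paths_def)
qed

lemma multichain_ends: "C ! 0 = P" "C ! k = top_path n"
  using C by (auto simp: multichains_def)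

lemma length_multichain: "length C = Suc k"
  using C by (simp add: multichains_def)

lemma multichain_cells_antimono: "s \<le> t \<Longrightarrow> t \<le> k \<Longrightarrow> cells (C ! t) \<subseteq> cells (C ! s)"
proof (induction t rule: dec_induct)
  case (step t)
  have "Suc t \<in> {1..k}" using step.prems by simp
  then have "path_le (C ! (Suc t - 1)) (C ! Suc t)"
    using C unfolding multichains_def by blast
  then have "cells (C ! Suc t) \<subseteq> cells (C ! t)"
    using cells_subset_iff[of "C ! t" "C ! Suc t"] by (simp add: path_le_def)
  then show ?case using step by auto
qed simp

lemma multichain_step:
  assumes "t \<in> {1..k}"
  shows "length (C ! t) = length (C ! (t - 1))" "cells (C ! t) \<subseteq> cells (C ! (t - 1))"
proof -
  have "t \<le> k" "t - 1 \<le> k" "t - 1 \<le> t" using assms by auto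
  then show "length (C ! t) = length (C ! (t - 1))" "cells (C ! t) \<subseteq> cells (C ! (t - 1))"
    by (simp_all only: multichain_length multichain_cells_antimono)
qed

text \<open>The diagrams decrease along \<open>C\<close>, so the times at which a cell is still present form
  an initial segment, and the least element in the definition decides membership at every time.\<close>

lemma chain_tableau_le_iff:
  assumes "c \<in> cells P" "s \<le> k"
  shows "chain_tableau k C c \<le> s \<longleftrightarrow> c \<in> cells (C ! (k - s))"
proof -
  have T: "chain_tableau k C c = (LEAST s. c \<in> cells (C ! (k - s)))"
    using assms by (simp add: chain_tableau_def multichain_ends)
  have "c \<in> cells (C ! (k - k))" using assms multichain_ends by simp
  then have "c \<in> cells (C ! (k - chain_tableau k C c))"
    unfolding T by (rule LeastI)
  then have "c \<in> cells (C ! (k - s))" if "chain_tableau k C c \<le> s"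
    using multichain_cells_antimono[of "k - s" "k - chain_tableau k C c"] diff_le_mono2[OF that, of k]
    by auto
  moreover have "chain_tableau k C c \<le> s" if "c \<in> cells (C ! (k - s))"
    unfolding T using that by (rule Least_le)
  ultimately show ?thesis by blast
qed

lemma chain_tableau_range:
  assumes "c \<in> cells P"
  shows "1 \<le> chain_tableau k C c" "chain_tableau k C c \<le> k"
proof -
  have "\<not> chain_tableau k C c \<le> 0"
    using chain_tableau_le_iff[OF assms, of 0] by (simp add: multichain_ends cells_top_path)
  then show "1 \<le> chain_tableau k C c" by simp
  show "chain_tableau k C c \<le> k"
    using chain_tableau_le_iff[OF assms, of k] assms by (simp add: multichain_ends)
qed

lemma chain_tableau_sublevel:
  assumes "t \<le> k"
  shows "cells (C ! t) = {c \<in> cells P. chain_tableau k C c \<le> k - t}"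
proof -
  have "cells (C ! t) \<subseteq> cells P"
    using multichain_cells_antimono[of 0 t] assms multichain_ends(1) by simp
  moreover have "chain_tableau k C c \<le> k - t \<longleftrightarrow> c \<in> cells (C ! t)" if "c \<in> cells P" for c
    using chain_tableau_le_iff[OF that, of "k - t"] assms by simp
  ultimately show ?thesis by blast
qed

lemma chain_tableau_level:
  assumes "t \<in> {1..k}"
  shows "cells (C ! (t - 1)) - cells (C ! t) = {c \<in> cells P. chain_tableau k C c = Suc k - t}"
proof -
  have "t \<le> k" "t - 1 \<le> k" and "\<And>v. v \<le> k - (t - 1) \<and> \<not> v \<le> k - t \<longleftrightarrow> v = Suc k - t"
    using assms by auto
  then show ?thesis
    unfolding chain_tableau_sublevel[OF \<open>t \<le> k\<close>] chain_tableau_sublevel[OF \<open>t - 1 \<le> k\<close>]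
    by blast
qed

text \<open>A cell to the left of or above another one belongs to every diagram that contains the
  other one, so it disappears no earlier.\<close>

lemma chain_tableau_shifted: "chain_tableau k C \<in> shifted_tableaux (partition_of P)"
proof -
  let ?T = "chain_tableau k C"
  have mono: "?T c \<le> ?T c'"
    if "c \<in> cells P" "c' \<in> cells P" "\<And>Q. c' \<in> cells Q \<Longrightarrow> c \<in> cells Q" for c c'
    using chain_tableau_le_iff[of c "?T c'"] chain_tableau_le_iff[of c' "?T c'"]
      chain_tableau_range(2)[of c'] that by blast
  have "?T (i, j) \<le> ?T (i, j')"
    if "(i, j) \<in> cells P" "(i, j') \<in> cells P" "j < j'" for i j j'
    using that mem_cells_bounds[of i j P] by (intro mono) (auto intro: cells_row_closed)
  moreover have "?T (i, j) \<le> ?T (i', j)"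
    if "(i, j) \<in> cells P" "(i', j) \<in> cells P" "i < i'" for i i' j
    using that mem_cells_bounds[of i j P]
    by (intro mono) (auto intro: cells_column_closed[of i' j _ i])
  moreover have "?T \<in> cells P \<rightarrow>\<^sub>E {1..}"
    using chain_tableau_range by (auto simp: chain_tableau_def multichain_ends)
  ultimately show ?thesis unfolding shifted_tableaux_def by blast
qed

text \<open>Step \<open>t\<close> of the multichain corresponds to the entry \<open>k + 1 - t\<close>; this turns
  quantification over steps into quantification over entries.\<close>

lemma all_levels_iff: "(\<forall>t\<in>{1..k}. R (Suc k - t)) \<longleftrightarrow> (\<forall>s\<in>{1..k}. R s)"
proof
  assume *: "\<forall>t\<in>{1..k}. R (Suc k - t)"
  show "\<forall>s\<in>{1..k}. R s"
  proof
    fix s assume "s \<in> {1..k}"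
    then have "Suc k - s \<in> {1..k}" "Suc k - (Suc k - s) = s" by auto
    with * show "R s" by metis
  qed
next
  assume *: "\<forall>s\<in>{1..k}. R s"
  show "\<forall>t\<in>{1..k}. R (Suc k - t)"
  proof
    fix t assume "t \<in> {1..k}"
    then have "Suc k - t \<in> {1..k}" by auto
    with * show "R (Suc k - t)" by blast
  qed
qed

lemma is_chain_iff: "is_chain C \<longleftrightarrow> entries (partition_of P) (chain_tableau k C) = {1..k}"
proof -
  let ?T = "chain_tableau k C"
  have nonempty_fibre: "{c \<in> A. g c = s} \<noteq> {} \<longleftrightarrow> s \<in> g ` A"
    for A :: "(nat \<times> nat) set" and g and s :: nat
    by blast
  have "path_less (C ! (t - 1)) (C ! t) \<longleftrightarrow> Suc k - t \<in> ?T ` cells P" if t: "t \<in> {1..k}" for t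
  proof -
    note len = multichain_step(1)[OF t, symmetric] and sub = multichain_step(2)[OF t]
    then have "path_less (C ! (t - 1)) (C ! t) \<longleftrightarrow> C ! (t - 1) \<noteq> C ! t"
      using cells_subset_iff[OF len] by (simp add: path_less_def)
    also have "\<dots> \<longleftrightarrow> cells (C ! (t - 1)) - cells (C ! t) \<noteq> {}"
      using cells_inject[OF len] sub by auto
    also have "\<dots> \<longleftrightarrow> Suc k - t \<in> ?T ` cells P"
      unfolding chain_tableau_level[OF t] by (rule nonempty_fibre)
    finally show ?thesis .
  qed
  moreover have "{1..<length C} = {1..k}" using length_multichain by auto
  ultimately have "is_chain C \<longleftrightarrow> (\<forall>s\<in>{1..k}. s \<in> ?T ` cells P)"
    unfolding all_levels_iff[of "\<lambda>s. s \<in> ?T ` cells P", symmetric] by (simp add: is_chain_def)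
  moreover have "?T ` cells P \<subseteq> {1..k}" using chain_tableau_range by auto
  ultimately show ?thesis unfolding entries_def by blast
qed

text \<open>By \<open>turn_valleys_iff\<close>, small intervals mean that distinct cells in a common row
  or column never carry the same entry; as the filling is already weakly monotone, this is strictness.\<close>

lemma has_small_intervals_iff:
  "has_small_intervals C \<longleftrightarrow> is_increasing_tableau (partition_of P) (chain_tableau k C)"
proof -
  let ?T = "chain_tableau k C"
  define level where "level = (\<lambda>s. {c \<in> cells P. ?T c = s})"
  have "(\<exists>S\<subseteq>valleys (C ! (t - 1)). C ! t = turn_valleys (C ! (t - 1)) S) \<longleftrightarrow>
          inj_on fst (level (Suc k - t)) \<and> inj_on snd (level (Suc k - t))"
    if t: "t \<in> {1..k}" for t
    using turn_valleys_iff[OF multichain_step[OF t]]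
    unfolding chain_tableau_level[OF t] level_def .
  moreover have "{1..<length C} = {1..k}" using length_multichain by auto
  ultimately have "has_small_intervals C \<longleftrightarrow>
      (\<forall>s\<in>{1..k}. inj_on fst (level s) \<and> inj_on snd (level s))"
    unfolding all_levels_iff[of "\<lambda>s. inj_on fst (level s) \<and> inj_on snd (level s)", symmetric]
    by (simp add: has_small_intervals_def)
  also have "\<dots> \<longleftrightarrow> (\<forall>c\<in>cells P. \<forall>c'\<in>cells P. c \<noteq> c' \<longrightarrow>
      fst c = fst c' \<or> snd c = snd c' \<longrightarrow> ?T c \<noteq> ?T c')"
    (is "?LHS \<longleftrightarrow> ?RHS")
  proof
    assume inj: ?LHS
    show ?RHS
    proof (intro ballI impI notI)
      fix c c' assume c: "c \<in> cells P" "c' \<in> cells P" "c \<noteq> c'"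
        and eq: "fst c = fst c' \<or> snd c = snd c'" "?T c = ?T c'"
      have "?T c \<in> {1..k}" "c \<in> level (?T c)" "c' \<in> level (?T c)"
        using c eq chain_tableau_range[OF c(1)] by (simp_all add: level_def)
      then show False using inj c(3) eq(1) by (blast dest: inj_onD)
    qed
  next
    assume *: ?RHS
    have "c = c'" if "c \<in> level s" "c' \<in> level s" "fst c = fst c' \<or> snd c = snd c'" for s c c'
    proof -
      have "c \<in> cells P" "c' \<in> cells P" "?T c = ?T c'"
        using that by (simp_all add: level_def)
      with * that(3) show ?thesis by blast
    qed
    then show ?LHS by (blast intro: inj_onI)
  qed
  also have "\<dots> \<longleftrightarrow> is_increasing_tableau (partition_of P) ?T" (is "?L \<longleftrightarrow> ?R")
  proof
    assume ?L
    then show ?R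
      using chain_tableau_shifted
      unfolding is_increasing_tableau_def shifted_tableaux_def
      by (auto simp: order_less_le)
  next
    assume ?R
    then show ?L
      unfolding is_increasing_tableau_def
      by auto (metis linorder_neqE_nat less_irrefl)+
  qed
  finally show ?thesis .
qed

lemma is_saturated_chain_iff_unique_entries:
  "is_saturated_chain C \<longleftrightarrow> (\<forall>s\<in>{1..k}. \<exists>!c. c \<in> cells P \<and> chain_tableau k C c = s)"
proof -
  let ?T = "chain_tableau k C"
  have singleton_fibre: "(\<exists>c. {c \<in> A. g c = s} = {c}) \<longleftrightarrow> (\<exists>!c. c \<in> A \<and> g c = s)"
    for A :: "(nat \<times> nat) set" and g and s :: nat
    unfolding Ex1_def set_eq_iff by blast
  have "covers (C ! t) (C ! (t - 1)) \<longleftrightarrow> (\<exists>!c. c \<in> cells P \<and> ?T c = Suc k - t)"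
    if t: "t \<in> {1..k}" for t
  proof -
    have "covers (C ! t) (C ! (t - 1)) \<longleftrightarrow> (\<exists>c. {c \<in> cells P. ?T c = Suc k - t} = {c})"
      using covers_iff_single_cell[OF multichain_step[OF t]]
      unfolding chain_tableau_level[OF t] .
    then show ?thesis unfolding singleton_fibre .
  qed
  moreover have "{1..<length C} = {1..k}" using length_multichain by auto
  moreover have "is_saturated_chain C \<longleftrightarrow> (\<forall>t\<in>{1..<length C}. covers (C ! t) (C ! (t - 1)))"
    by (auto simp: is_saturated_chain_def is_chain_def covers_iff)
  ultimately show ?thesis
    unfolding all_levels_iff[of "\<lambda>s. \<exists>!c. c \<in> cells P \<and> ?T c = s", symmetric] by simp
qed

text \<open>
  If every entry from \<open>1\<close> to \<open>k\<close> occurs once, the filling is a bijection onto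
  \<open>{1..k}\<close>, so \<open>k\<close> is the number of cells; it is increasing because a saturated chain
  has small intervals.  Conversely, a standard filling attains as many values as there are cells,
  hence no others, and its maximum is the number of cells.
\<close>

lemma is_saturated_chain_iff:
  assumes "k \<ge> 1" "cells P \<noteq> {}"
  shows "is_saturated_chain C \<longleftrightarrow>
    is_standard_tableau (partition_of P) (chain_tableau k C) \<and>
    max_entry (partition_of P) (chain_tableau k C) = k"
proof
  let ?T = "chain_tableau k C"
  assume sat: "is_saturated_chain C"
  then have unique: "\<forall>s\<in>{1..k}. \<exists>!c. c \<in> cells P \<and> ?T c = s"
    by (simp add: is_saturated_chain_iff_unique_entries)
  have range: "?T c \<in> {1..k}" if "c \<in> cells P" for c
    using chain_tableau_range[OF that] by simp
  have "inj_on ?T (cells P)"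
    using unique range by (intro inj_onI) blast
  moreover have img: "?T ` cells P = {1..k}"
    using unique range by blast
  ultimately have "sum_list (partition_of P) = k"
    using card_image[of ?T "cells P"] card_shifted_diagram by simp
  moreover have "has_small_intervals C"
    using sat unfolding is_saturated_chain_def has_small_intervals_def covers_def by blast
  moreover have "max_entry (partition_of P) ?T = k"
    using img assms(1) by (auto simp: max_entry_def entries_def intro!: Max_eqI)
  ultimately show "is_standard_tableau (partition_of P) ?T \<and> max_entry (partition_of P) ?T = k"
    using unique has_small_intervals_iff by (simp add: is_standard_tableau_def)
next
  let ?T = "chain_tableau k C" and ?N = "sum_list (partition_of P)"
  assume *: "is_standard_tableau (partition_of P) ?T \<and> max_entry (partition_of P) ?T = k"
  then have unique: "\<forall>v\<in>{1..?N}. \<exists>!c. c \<in> cells P \<and> ?T c = v"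
    by (simp add: is_standard_tableau_def)
  have "card (?T ` cells P) \<le> ?N"
    using card_image_le[OF finite_shifted_diagram, of ?T] card_shifted_diagram by metis
  moreover have "{1..?N} \<subseteq> ?T ` cells P"
    using unique by blast
  ultimately have img: "?T ` cells P = {1..?N}"
    by (intro card_seteq[symmetric]) (auto simp: finite_shifted_diagram)
  then have "{1..?N} \<noteq> {}"
    using assms(2) by auto
  then have "Max {1..?N} = ?N" by (intro Max_eqI) auto
  then have "k = ?N" using * img by (simp add: max_entry_def entries_def)
  then show "is_saturated_chain C"
    using unique by (simp add: is_saturated_chain_iff_unique_entries)
qed

end

section \<open>Multichains and bounded tableaux correspond\<close>

lemma inj_on_chain_tableau: "inj_on (chain_tableau k) (multichains n P (top_path n) k)"
proof (rule inj_onI)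
  fix C C' assume C: "C \<in> multichains n P (top_path n) k" "C' \<in> multichains n P (top_path n) k"
    and eq: "chain_tableau k C = chain_tableau k C'"
  show "C = C'"
  proof (rule nth_equalityI)
    show "length C = length C'" using length_multichain C by simp
    fix t assume "t < length C"
    then have "t \<le> k" using length_multichain[OF C(1)] by simp
    then show "C ! t = C' ! t"
      using chain_tableau_sublevel[OF C(1)] chain_tableau_sublevel[OF C(2)] eq
        multichain_length[OF C(1)] multichain_length[OF C(2)]
      by (intro cells_inject) auto
  qed
qed

text \<open>The sublevel sets of a tableau are order ideals and hence diagrams of paths.  The positivity
  of the entries makes the last one empty, and the bound \<open>k\<close> makes the first one the diagram of
  \<open>P\<close>.\<close>

lemma ex_multichain_of_tableau:
  assumes P: "length P = n" and T: "T \<in> shifted_tableaux (partition_of P)"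
    and le: "\<And>c. c \<in> cells P \<Longrightarrow> T c \<le> k"
  shows "\<exists>C\<in>multichains n P (top_path n) k. chain_tableau k C = T"
proof -
  define J where "J = (\<lambda>t. {c \<in> cells P. T c \<le> k - t})"
  have pos: "1 \<le> T c" if "c \<in> cells P" for c
    using T that by (auto simp: shifted_tableaux_def)
  have row: "T (i, j) \<le> T (i, j')" if "(i, j) \<in> cells P" "(i, j') \<in> cells P" "j \<le> j'" for i j j'
    using T that by (cases "j = j'") (auto simp: shifted_tableaux_def)
  have column: "T (i, j) \<le> T (i', j)" if "(i, j) \<in> cells P" "(i', j) \<in> cells P" "i \<le> i'" for i i' j
    using T that by (cases "i = i'") (auto simp: shifted_tableaux_def)
  have "\<exists>Q. length Q = n \<and> cells Q = J t" for t
  proof (rule ex_path_of_order_ideal)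
    show "1 \<le> i \<and> i \<le> j \<and> j \<le> n" if "(i, j) \<in> J t" for i j
      using that mem_cells_bounds[of i j P] P by (simp add: J_def)
    show "(i, j) \<in> J t" if "(i, j') \<in> J t" "i \<le> j" "j \<le> j'" for i j j'
      using that cells_row_closed[of i j' P j] row[of i j j'] by (auto simp: J_def)
    show "(i, j) \<in> J t" if "(i', j) \<in> J t" "1 \<le> i" "i \<le> i'" for i i' j
      using that cells_column_closed[of i' j P i] column[of i j i'] by (auto simp: J_def)
  qed
  then obtain Q where Q: "\<And>t. length (Q t) = n" "\<And>t. cells (Q t) = J t"
    by metis
  define C where "C = map Q [0..<Suc k]"
  have nth: "C ! t = Q t" if "t \<le> k" for t
    using that by (simp add: C_def del: upt_Suc)
  have "Q 0 = P"
    using Q le P by (intro cells_inject) (auto simp: J_def)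
  moreover have "Q k = top_path n"
  proof (rule cells_inject)
    show "length (Q k) = length (top_path n)" by (simp add: Q top_path_def)
    show "cells (Q k) = cells (top_path n)"
      using pos by (fastforce simp: Q J_def cells_top_path)
  qed
  moreover have "path_le (Q (t - 1)) (Q t)" for t
    using cells_subset_iff[of "Q (t - 1)" "Q t"] Q by (auto simp: J_def)
  ultimately have C: "C \<in> multichains n P (top_path n) k"
    using nth Q(1) unfolding multichains_def paths_def
    by (auto simp: C_def simp del: upt_Suc)
  have "chain_tableau k C = T"
  proof
    fix c
    show "chain_tableau k C c = T c"
    proof (cases "c \<in> cells P")
      case True
      have iff: "chain_tableau k C c \<le> s \<longleftrightarrow> T c \<le> s" if "s \<le> k" for s
        using chain_tableau_le_iff[OF C True that] nth[of "k - s"] Q(2) True that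
        by (simp add: J_def)
      show ?thesis
        using iff[of "T c"] iff[of "chain_tableau k C c"] le[OF True]
          chain_tableau_range(2)[OF C True] by (simp add: antisym)
    next
      case False
      have "T \<in> cells P \<rightarrow>\<^sub>E {1..}"
        using T by (simp add: shifted_tableaux_def)
      then have "T c = undefined" using False by (rule PiE_arb)
      then show ?thesis
        using False by (simp add: chain_tableau_def multichain_ends(1)[OF C])
    qed
  qed
  with C show ?thesis by blast
qed

theorem proposition5:
  fixes n k :: nat and P :: path
  assumes "P \<in> paths n" and "P \<noteq> []" and "hd P = D" and "k \<ge> 1"
  shows "\<exists>f. bij_betw f (multichains n P (top_path n) k)
               {T \<in> shifted_tableaux (partition_of P). max_entry (partition_of P) T \<le> k} \<and>
             (\<forall>C \<in> multichains n P (top_path n) k.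
                (is_chain C \<longleftrightarrow> entries (partition_of P) (f C) = {1..k}) \<and>
                (has_small_intervals C \<longleftrightarrow> is_increasing_tableau (partition_of P) (f C)) \<and>
                (is_saturated_chain C \<longleftrightarrow>
                   is_standard_tableau (partition_of P) (f C) \<and>
                   max_entry (partition_of P) (f C) = k))"
proof -
  have len: "length P = n" using assms(1) by (simp add: paths_def)
  have "(1, 1) \<in> cells P"
    using assms(2,3) by (cases P) (auto simp: mem_cells_iff downs_def)
  then have ne: "cells P \<noteq> {}" by blast
  have max_le_iff: "max_entry (partition_of P) T \<le> k \<longleftrightarrow> (\<forall>c\<in>cells P. T c \<le> k)" for T
    using ne by (simp add: max_entry_def entries_def finite_shifted_diagram)
  have "chain_tableau k ` multichains n P (top_path n) k =
      {T \<in> shifted_tableaux (partition_of P). max_entry (partition_of P) T \<le> k}"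
  proof
    show "chain_tableau k ` multichains n P (top_path n) k \<subseteq>
        {T \<in> shifted_tableaux (partition_of P). max_entry (partition_of P) T \<le> k}"
      using chain_tableau_shifted chain_tableau_range(2) by (auto simp: max_le_iff)
    show "{T \<in> shifted_tableaux (partition_of P). max_entry (partition_of P) T \<le> k} \<subseteq>
        chain_tableau k ` multichains n P (top_path n) k"
      using ex_multichain_of_tableau[OF len] by (fastforce simp: max_le_iff)
  qed
  then have "bij_betw (chain_tableau k) (multichains n P (top_path n) k)
      {T \<in> shifted_tableaux (partition_of P). max_entry (partition_of P) T \<le> k}"
    using inj_on_chain_tableau by (simp add: bij_betw_def)
  then show ?thesis
    using is_chain_iff has_small_intervals_iff is_saturated_chain_iff[OF _ assms(4) ne] by blast
qed

end
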